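(* Let $S$ be a subsemigroup of $((0,\infty),+)$ which is dense in $(0,\infty)$. Let $u,v\in\mathbb N$ and let $D$ be a $u\times v$ image partition regular matrix. Let $\alpha$ and $\delta$ be positive countable ordinals and let $A$ be an $\alpha\times v$ matrix all of whose rows are rows of $D$. Let $B$ be an $\alpha\times\delta$ member of $\mathcal R_0(S)$ and let $M\in\mathcal N_0(S)$. Then $\begin{pmatrix}A&B&0\\0&0&M\end{pmatrix}\in\mathcal N_0(S)$.
   Context: A matrix (rows/columns indexed by countable ordinals) is admissible if its entries are rational, no row is $\vec 0$, and each row has finitely many nonzero entries. A finite $u\times v$ rational matrix $D$ is image partition regular if it has no zero row and whenever $\mathbb N$ is finitely colored there is $\vec x\in\mathbb N^v$ with all entries of $D\vec x$ of one color. $\beta S$ is the set of ultrafilters on $S$ with $B\in p+q$ iff $\{x\in S:-x+B\in q\}\in p$; $O^+(S)=\{p\in\beta S:(0,\varepsilon)\cap S\in p$ for all $\varepsilon>0\}$, with smallest ideal $K(O^+(S))$. For an $\alpha\times\delta$ rational matrix $A$: $I(A;S)=\{p\in\beta S:$ for every $P\in p$ there is $\vec x\in S^\delta$ with all entries of $A\vec x$ in $P\}$; $I_0(A;S)=\{p\in\beta S:$ for every $P\in p$ and $\varepsilon>0$ there is $\vec x\in S^\delta$ with all entries of $A\vec x$ in $P\cap(0,\varepsilon)\}$. $\mathcal N_0(S)$: admissible $M$ with $I(E;S)\cap I(M;S)\cap K(O^+(S))\neq\emptyset$ for every finite image partition regular $E$. $\mathcal R_0(S)$: admissible $M$ such that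 for every finite image partition regular $E$ and every left ideal $L$ of the semigroup $I_0(E;S)$, $L\cap I_0(M;S)\neq\emptyset$. *)

theory Defs
  imports "HOL-Analysis.Analysis"
begin

text \<open>
  An ordinal is represented by a (reflexive) well-order relation; the field of the relation is the
  index set, and the empty relation is the ordinal 0. The natural number \<open>n\<close> is \<^term>\<open>natLeq_on n\<close>,
  whose field is \<open>{0, \<dots>, n - 1}\<close>. Values of \<open>entry\<close> outside the two fields are irrelevant.
\<close>

definition countable_ordinal :: "'a rel \<Rightarrow> bool" where
  "countable_ordinal r \<longleftrightarrow> Well_order r \<and> countable (Field r)"

definition ord_sum :: "'a rel \<Rightarrow> 'b rel \<Rightarrow> ('a + 'b) rel" where
  "ord_sum r s =
     map_prod Inl Inl ` r \<union> map_prod Inr Inr ` s \<union> {(Inl a, Inr b) |a b. a \<in> Field r \<and> b \<in> Field s}"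

record ('a, 'b) omat =
  row_ord :: "'a rel"
  col_ord :: "'b rel"
  entry :: "'a \<Rightarrow> 'b \<Rightarrow> rat"

definition row_support :: "('a, 'b) omat \<Rightarrow> 'a \<Rightarrow> 'b set" where
  "row_support M i = {j \<in> Field (col_ord M). entry M i j \<noteq> 0}"

definition admissible :: "('a, 'b) omat \<Rightarrow> bool" where
  "admissible M \<longleftrightarrow>
     countable_ordinal (row_ord M) \<and> countable_ordinal (col_ord M) \<and>
     (\<forall>i\<in>Field (row_ord M). row_support M i \<noteq> {} \<and> finite (row_support M i))"

definition mat_vec :: "('a, 'b) omat \<Rightarrow> ('b \<Rightarrow> real) \<Rightarrow> 'a \<Rightarrow> real" where
  "mat_vec M x i = (\<Sum>j\<in>row_support M i. of_rat (entry M i j) * x j)"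

definition is_dim :: "nat \<Rightarrow> nat \<Rightarrow> (nat, nat) omat \<Rightarrow> bool" where
  "is_dim u v D \<longleftrightarrow> row_ord D = natLeq_on u \<and> col_ord D = natLeq_on v"

text \<open>
  The block matrix with first row of blocks \<open>A\<close>, \<open>B\<close>, 0 and second row of blocks 0, 0, \<open>M\<close>,
  meaningful when \<open>A\<close> and \<open>B\<close> have the same row ordinal.
\<close>

definition block_mat ::
  "('a, 'n) omat \<Rightarrow> ('a, 'd) omat \<Rightarrow> ('b, 'e) omat \<Rightarrow> ('a + 'b, 'n + 'd + 'e) omat" where
  "block_mat A B M =
    \<lparr> row_ord = ord_sum (row_ord A) (row_ord M),
      col_ord = ord_sum (col_ord A) (ord_sum (col_ord B) (col_ord M)),
      entry = (\<lambda>i j. case i of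
          Inl i' \<Rightarrow> (case j of
              Inl k \<Rightarrow> entry A i' k
            | Inr (Inl k) \<Rightarrow> entry B i' k
            | Inr (Inr k) \<Rightarrow> 0)
        | Inr i' \<Rightarrow> (case j of
              Inl k \<Rightarrow> 0
            | Inr (Inl k) \<Rightarrow> 0
            | Inr (Inr k) \<Rightarrow> entry M i' k)) \<rparr>"

text \<open>
  The colored numbers are the positive integers, and monochromaticity includes that all entries of \<open>D x\<close> are positive integers.
\<close>

definition image_partition_regular :: "nat \<Rightarrow> nat \<Rightarrow> (nat, nat) omat \<Rightarrow> bool" where
  "image_partition_regular u v D \<longleftrightarrow>
     0 < u \<and> 0 < v \<and> is_dim u v D \<and> (\<forall>i<u. \<exists>j<v. entry D i j \<noteq> 0) \<and>
     (\<forall>(k::nat) (c :: nat \<Rightarrow> nat). (\<forall>n>0. c n < k) \<longrightarrow>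
        (\<exists>x :: nat \<Rightarrow> nat. (\<forall>j<v. 0 < x j) \<and>
           (\<exists>m. \<forall>i<u. \<exists>n>0. mat_vec D (\<lambda>j. real (x j)) i = real n \<and> c n = m)))"

definition finite_ipr :: "(nat, nat) omat \<Rightarrow> bool" where
  "finite_ipr E \<longleftrightarrow> (\<exists>u v. image_partition_regular u v E)"

definition dense_subsemigroup :: "real set \<Rightarrow> bool" where
  "dense_subsemigroup S \<longleftrightarrow>
     S \<subseteq> {0<..} \<and> (\<forall>x\<in>S. \<forall>y\<in>S. x + y \<in> S) \<and> {0<..} \<subseteq> closure S"

definition ultrafilters :: "'a set \<Rightarrow> 'a set set set" where
  "ultrafilters S =
     {p. p \<subseteq> Pow S \<and> S \<in> p \<and> {} \<notin> p \<and>
         (\<forall>P Q. P \<in> p \<longrightarrow> Q \<in> p \<longrightarrow> P \<inter> Q \<in> p) \<and>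
         (\<forall>P Q. P \<in> p \<longrightarrow> P \<subseteq> Q \<longrightarrow> Q \<subseteq> S \<longrightarrow> Q \<in> p) \<and>
         (\<forall>P. P \<subseteq> S \<longrightarrow> P \<in> p \<or> S - P \<in> p)}"

definition uplus :: "real set \<Rightarrow> real set set \<Rightarrow> real set set \<Rightarrow> real set set" where
  "uplus S p q = {B. B \<subseteq> S \<and> {x\<in>S. {y\<in>S. x + y \<in> B} \<in> q} \<in> p}"

definition O_plus :: "real set \<Rightarrow> real set set set" where
  "O_plus S = {p \<in> ultrafilters S. \<forall>\<epsilon>>0. {0<..<\<epsilon>} \<inter> S \<in> p}"

definition left_ideal :: "('p \<Rightarrow> 'p \<Rightarrow> 'p) \<Rightarrow> 'p set \<Rightarrow> 'p set \<Rightarrow> bool" where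
  "left_ideal f T L \<longleftrightarrow> L \<noteq> {} \<and> L \<subseteq> T \<and> (\<forall>t\<in>T. \<forall>l\<in>L. f t l \<in> L)"

definition right_ideal :: "('p \<Rightarrow> 'p \<Rightarrow> 'p) \<Rightarrow> 'p set \<Rightarrow> 'p set \<Rightarrow> bool" where
  "right_ideal f T R \<longleftrightarrow> R \<noteq> {} \<and> R \<subseteq> T \<and> (\<forall>r\<in>R. \<forall>t\<in>T. f r t \<in> R)"

text \<open>
  The smallest two-sided ideal, as the intersection of all two-sided ideals. It is itself an ideal
  whenever a smallest one exists, as is the case for compact right topological semigroups.
\<close>

definition smallest_ideal :: "('p \<Rightarrow> 'p \<Rightarrow> 'p) \<Rightarrow> 'p set \<Rightarrow> 'p set" where
  "smallest_ideal f T = \<Inter> {J. left_ideal f T J \<and> right_ideal f T J}"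

definition I_set :: "('a, 'b) omat \<Rightarrow> real set \<Rightarrow> real set set set" where
  "I_set A S = {p \<in> ultrafilters S. \<forall>P\<in>p.
     \<exists>x. (\<forall>j\<in>Field (col_ord A). x j \<in> S) \<and> (\<forall>i\<in>Field (row_ord A). mat_vec A x i \<in> P)}"

definition I0_set :: "('a, 'b) omat \<Rightarrow> real set \<Rightarrow> real set set set" where
  "I0_set A S = {p \<in> ultrafilters S. \<forall>P\<in>p. \<forall>\<epsilon>>0.
     \<exists>x. (\<forall>j\<in>Field (col_ord A). x j \<in> S) \<and>
         (\<forall>i\<in>Field (row_ord A). mat_vec A x i \<in> P \<inter> {0<..<\<epsilon>})}"

definition N0 :: "real set \<Rightarrow> ('a, 'b) omat set" where
  "N0 S = {M. admissible M \<and>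
     (\<forall>E. finite_ipr E \<longrightarrow>
        I_set E S \<inter> I_set M S \<inter> smallest_ideal (uplus S) (O_plus S) \<noteq> {})}"

definition R0 :: "real set \<Rightarrow> ('a, 'b) omat set" where
  "R0 S = {M. admissible M \<and>
     (\<forall>E L. finite_ipr E \<longrightarrow> left_ideal (uplus S) (I0_set E S) L \<longrightarrow> L \<inter> I0_set M S \<noteq> {})}"

end

theory Submission
  imports Defs
begin

text \<open>
  Given a finite image partition regular \<open>E\<close>, the diagonal sum of \<open>D\<close> and \<open>E\<close> is image partition
  regular, so some \<open>q\<close> in the smallest ideal of \<open>O\<^sup>+(S)\<close> lies in \<open>I(D)\<close>, \<open>I(E)\<close> and \<open>I(M)\<close>. It lies
  in \<open>T = I\<^sub>0(D)\<close>, and \<open>T + q\<close> is a minimal left ideal of \<open>T\<close>. Since \<open>B\<close> belongs to \<open>R\<^sub>0(S)\<close>, this left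
  ideal contains some \<open>r\<close> in \<open>I\<^sub>0(B)\<close>, and minimality gives \<open>q = s + r\<close> with \<open>s\<close> in \<open>T\<close>. A member of
  \<open>q\<close> then contains all sums of an image of \<open>D\<close> and an image of \<open>B\<close>, hence an image of \<open>(A B)\<close>, and also
  an image of \<open>M\<close>; so \<open>q\<close> itself is a witness for the block matrix.
\<close>

section \<open>Ultrafilters\<close>

lemma ultrafilter_subset: "p \<in> ultrafilters S \<Longrightarrow> P \<in> p \<Longrightarrow> P \<subseteq> S"
  by (auto simp: ultrafilters_def)

lemma ultrafilter_space: "p \<in> ultrafilters S \<Longrightarrow> S \<in> p"
  by (simp add: ultrafilters_def)

lemma ultrafilter_empty: "p \<in> ultrafilters S \<Longrightarrow> {} \<notin> p"
  by (simp add: ultrafilters_def)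

lemma ultrafilter_Int: "p \<in> ultrafilters S \<Longrightarrow> P \<in> p \<Longrightarrow> Q \<in> p \<Longrightarrow> P \<inter> Q \<in> p"
  by (simp add: ultrafilters_def)

lemma ultrafilter_mono: "p \<in> ultrafilters S \<Longrightarrow> P \<in> p \<Longrightarrow> P \<subseteq> Q \<Longrightarrow> Q \<subseteq> S \<Longrightarrow> Q \<in> p"
  unfolding ultrafilters_def mem_Collect_eq by (elim conjE) metis

lemma ultrafilter_Diff_iff: "p \<in> ultrafilters S \<Longrightarrow> P \<subseteq> S \<Longrightarrow> S - P \<in> p \<longleftrightarrow> P \<notin> p"
proof
  assume p: "p \<in> ultrafilters S" and "P \<subseteq> S" and "S - P \<in> p"
  moreover have "P \<inter> (S - P) = {}"
    by blast
  ultimately show "P \<notin> p"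
    using ultrafilter_Int[OF p, of P "S - P"] ultrafilter_empty[OF p] by auto
qed (simp add: ultrafilters_def, metis)

lemma ultrafilter_Int_iff:
  assumes "p \<in> ultrafilters S" "P \<subseteq> S" "Q \<subseteq> S"
  shows "P \<inter> Q \<in> p \<longleftrightarrow> P \<in> p \<and> Q \<in> p"
  using assms ultrafilter_Int ultrafilter_mono by (metis inf_le1 inf_le2)

lemma ultrafilter_Inter:
  assumes "p \<in> ultrafilters S" "finite F" "F \<subseteq> p"
  shows "S \<inter> \<Inter>F \<in> p"
  using assms(2,3)
proof (induction F)
  case empty
  then show ?case
    using ultrafilter_space[OF assms(1)] by simp
next
  case (insert P F)
  then have "P \<inter> (S \<inter> \<Inter>F) \<in> p"
    using ultrafilter_Int[OF assms(1)] by blast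
  then show ?case
    by (simp add: Int_left_commute)
qed

lemma ultrafilter_INT:
  assumes "p \<in> ultrafilters S" "finite I" "\<And>i. i \<in> I \<Longrightarrow> {x\<in>S. R i x} \<in> p"
  shows "{x\<in>S. \<forall>i\<in>I. R i x} \<in> p"
proof -
  have "S \<inter> \<Inter>((\<lambda>i. {x\<in>S. R i x}) ` I) \<in> p"
    using assms by (intro ultrafilter_Inter) auto
  moreover have "S \<inter> \<Inter>((\<lambda>i. {x\<in>S. R i x}) ` I) = {x\<in>S. \<forall>i\<in>I. R i x}"
    by auto
  ultimately show ?thesis
    by simp
qed

text \<open>A set in \<open>q\<close> but not in \<open>p\<close> would have its complement in
  \<open>p\<close>, hence in \<open>q\<close>. This lets later proofs establish equality of
  ultrafilters by one inclusion.\<close>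

lemma ultrafilter_maximal:
  assumes "p \<in> ultrafilters S" "q \<in> ultrafilters S" "p \<subseteq> q"
  shows "p = q"
proof -
  have "P \<in> p" if "P \<in> q" for P
    using that assms ultrafilter_subset[OF assms(2) that] ultrafilter_Diff_iff by blast
  then show ?thesis
    using assms(3) by blast
qed

lemma ultrafilter_finite_cover:
  assumes "p \<in> ultrafilters S" "finite I" "S \<subseteq> (\<Union>i\<in>I. X i)"
  obtains i where "i \<in> I" "S \<inter> X i \<in> p"
proof -
  have False if "\<And>i. i \<in> I \<Longrightarrow> S \<inter> X i \<notin> p"
  proof -
    have "{x\<in>S. x \<notin> X i} \<in> p" if "i \<in> I" for i
    proof -
      have "S - S \<inter> X i \<in> p"
        using \<open>i \<in> I\<close> \<open>\<And>i. i \<in> I \<Longrightarrow> S \<inter> X i \<notin> p\<close> ultrafilter_Diff_iff[OF assms(1)] by blast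
      moreover have "S - S \<inter> X i = {x\<in>S. x \<notin> X i}"
        by blast
      ultimately show ?thesis
        by simp
    qed
    then have "{x\<in>S. \<forall>i\<in>I. x \<notin> X i} \<in> p"
      by (intro ultrafilter_INT assms)
    moreover have "{x\<in>S. \<forall>i\<in>I. x \<notin> X i} = {}"
      using assms(3) by blast
    ultimately show False
      using ultrafilter_empty[OF assms(1)] by simp
  qed
  then show thesis
    using that by blast
qed

text \<open>By Zorn, \<open>G\<close> extends to a family maximal with the finite intersection
  property, and such a family is an ultrafilter. Intersecting with \<open>S\<close> gives
  \<open>\<Inter>F\<close> the right meaning for empty \<open>F\<close>: the hypothesis then says
  that \<open>S\<close> is nonempty.\<close>

lemma ultrafilter_exists:
  assumes "G \<subseteq> Pow S" and fip: "\<And>F. finite F \<Longrightarrow> F \<subseteq> G \<Longrightarrow> S \<inter> \<Inter>F \<noteq> {}"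
  obtains p where "p \<in> ultrafilters S" "G \<subseteq> p"
proof -
  define A where "A = {H. G \<subseteq> H \<and> H \<subseteq> Pow S \<and> (\<forall>F. finite F \<longrightarrow> F \<subseteq> H \<longrightarrow> S \<inter> \<Inter>F \<noteq> {})}"
  have "\<exists>p\<in>A. \<forall>X\<in>A. p \<subseteq> X \<longrightarrow> X = p"
  proof (rule subset_Zorn_nonempty)
    show "A \<noteq> {}"
      using assms unfolding A_def by blast
  next
    fix C assume C: "C \<noteq> {}" "subset.chain A C"
    then have CA: "C \<subseteq> A"
      by (simp add: subset_chain_def)
    have "S \<inter> \<Inter>F \<noteq> {}" if F: "finite F" "F \<subseteq> \<Union>C" for F
    proof -
      obtain B where "B \<in> C" "F \<subseteq> B"
        using finite_subset_Union_chain[OF F C] .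
      moreover have "B \<in> A"
        using CA \<open>B \<in> C\<close> by blast
      ultimately show ?thesis
        using F(1) by (simp add: A_def)
    qed
    moreover have "G \<subseteq> H \<and> H \<subseteq> Pow S" if "H \<in> C" for H
      using CA that by (auto simp: A_def)
    then have "G \<subseteq> \<Union>C" "\<Union>C \<subseteq> Pow S"
      using C(1) by blast+
    ultimately show "\<Union>C \<in> A"
      by (simp add: A_def)
  qed
  then obtain p where p: "p \<in> A" and max: "\<And>X. X \<in> A \<Longrightarrow> p \<subseteq> X \<Longrightarrow> X = p"
    by blast
  have pS: "p \<subseteq> Pow S" and pG: "G \<subseteq> p"
    and pfip: "\<And>F. finite F \<Longrightarrow> F \<subseteq> p \<Longrightarrow> S \<inter> \<Inter>F \<noteq> {}"
    using p unfolding A_def by simp_all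
  \<comment> \<open>Maximality in usable form: a subset of \<open>S\<close> that meets every finite
    intersection from \<open>p\<close> belongs to \<open>p\<close>. Membership claims in the
    ultrafilter axioms below reduce to this.\<close>
  have mem: "P \<in> p" if "P \<subseteq> S" "\<And>F. finite F \<Longrightarrow> F \<subseteq> p \<Longrightarrow> S \<inter> \<Inter>F \<inter> P \<noteq> {}" for P
  proof -
    have "S \<inter> \<Inter>F \<noteq> {}" if "finite F" "F \<subseteq> insert P p" for F
    proof -
      have "S \<inter> \<Inter>(F - {P}) \<inter> P \<noteq> {}"
        using that by (intro \<open>\<And>F. finite F \<Longrightarrow> F \<subseteq> p \<Longrightarrow> S \<inter> \<Inter>F \<inter> P \<noteq> {}\<close>) auto
      then show ?thesis
        by blast
    qed
    then have "insert P p \<in> A"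
      using pS pG \<open>P \<subseteq> S\<close> unfolding A_def by auto
    then show ?thesis
      using max[of "insert P p"] by blast
  qed
  have "p \<in> ultrafilters S"
    unfolding ultrafilters_def
  proof (intro CollectI conjI allI impI)
    show "p \<subseteq> Pow S"
      by (fact pS)
    show "S \<in> p"
      using pfip by (intro mem) auto
    show "{} \<notin> p"
      using pfip[of "{{}}"] by auto
  next
    fix P Q assume "P \<in> p" "Q \<in> p"
    then have "S \<inter> \<Inter>F \<inter> (P \<inter> Q) \<noteq> {}" if "finite F" "F \<subseteq> p" for F
      using pfip[of "insert P (insert Q F)"] that by auto
    then show "P \<inter> Q \<in> p"
      using \<open>P \<in> p\<close> pS by (intro mem) auto
  next
    fix P Q assume "P \<in> p" "P \<subseteq> Q" "Q \<subseteq> S"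
    then have "S \<inter> \<Inter>F \<inter> Q \<noteq> {}" if "finite F" "F \<subseteq> p" for F
      using pfip[of "insert P F"] that by auto
    then show "Q \<in> p"
      using \<open>Q \<subseteq> S\<close> by (intro mem) auto
  next
    fix P assume "P \<subseteq> S"
    show "P \<in> p \<or> S - P \<in> p"
    proof (rule ccontr)
      assume "\<not> ?thesis"
      \<comment> \<open>If both \<open>P\<close> and \<open>S - P\<close> were missing, each would
        be disjoint from some finite intersection; merging the two finite families gives an empty
        intersection.\<close>
      then obtain F F' where "finite F" "F \<subseteq> p" "S \<inter> \<Inter>F \<inter> P = {}"
        and "finite F'" "F' \<subseteq> p" "S \<inter> \<Inter>F' \<inter> (S - P) = {}"
        using mem[of P] mem[of "S - P"] \<open>P \<subseteq> S\<close> by blast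
      then have "finite (F \<union> F')" "F \<union> F' \<subseteq> p"
        by simp_all
      moreover have "S \<inter> \<Inter>(F \<union> F') = {}"
        using \<open>S \<inter> \<Inter>F \<inter> P = {}\<close> \<open>S \<inter> \<Inter>F' \<inter> (S - P) = {}\<close> by blast
      ultimately show False
        using pfip by blast
    qed
  qed
  then show thesis
    using that pG by blast
qed

section \<open>Closed sets and compactness of the space of ultrafilters\<close>

text \<open>Closedness in the Stone topology: every closed set is the set of ultrafilters above some filter.\<close>

definition uf_closed :: "'a set \<Rightarrow> 'a set set set \<Rightarrow> bool" where
  "uf_closed S A \<longleftrightarrow> A \<subseteq> ultrafilters S \<and> (\<forall>p\<in>ultrafilters S. \<Inter>A \<subseteq> p \<longrightarrow> p \<in> A)"

lemma uf_closed_subset: "uf_closed S A \<Longrightarrow> A \<subseteq> ultrafilters S"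
  by (simp add: uf_closed_def)

lemma uf_closedD: "uf_closed S A \<Longrightarrow> p \<in> ultrafilters S \<Longrightarrow> \<Inter>A \<subseteq> p \<Longrightarrow> p \<in> A"
  by (simp add: uf_closed_def)

text \<open>The neighbourhood form of closedness: the second assumption gives each outside point a
  basic open set disjoint from \<open>A\<close>. Then \<open>S - P\<close> lies in every member of
  \<open>A\<close>, hence in \<open>\<Inter>A\<close>, but not in \<open>p\<close>.\<close>

lemma uf_closedI:
  assumes "A \<subseteq> ultrafilters S"
    and "\<And>p. p \<in> ultrafilters S \<Longrightarrow> p \<notin> A \<Longrightarrow> \<exists>P\<in>p. \<forall>q\<in>A. P \<notin> q"
  shows "uf_closed S A"
  unfolding uf_closed_def
proof (intro conjI ballI impI)
  fix p assume p: "p \<in> ultrafilters S" "\<Inter>A \<subseteq> p"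
  show "p \<in> A"
  proof (rule ccontr)
    assume "p \<notin> A"
    then obtain P where P: "P \<in> p" "\<forall>q\<in>A. P \<notin> q"
      using assms(2) p(1) by blast
    then have "P \<subseteq> S"
      using ultrafilter_subset[OF p(1)] by simp
    then have "S - P \<in> q" if "q \<in> A" for q
      using P(2) that assms(1) ultrafilter_Diff_iff by (metis subsetD)
    then have "S - P \<in> p"
      using p(2) by blast
    then show False
      using P(1) ultrafilter_Diff_iff[OF p(1) \<open>P \<subseteq> S\<close>] by simp
  qed
qed (fact assms(1))

lemma uf_closed_Inter:
  assumes "\<C> \<noteq> {}" "\<And>A. A \<in> \<C> \<Longrightarrow> uf_closed S A"
  shows "uf_closed S (\<Inter>\<C>)"
  unfolding uf_closed_def
proof (intro conjI ballI impI)
  show "\<Inter>\<C> \<subseteq> ultrafilters S"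
    using assms uf_closed_subset by blast
next
  fix p assume p: "p \<in> ultrafilters S" "\<Inter>(\<Inter>\<C>) \<subseteq> p"
  have "p \<in> A" if "A \<in> \<C>" for A
  proof (rule uf_closedD[OF assms(2)[OF that] p(1)])
    have "\<Inter>A \<subseteq> \<Inter>(\<Inter>\<C>)"
      using that by blast
    then show "\<Inter>A \<subseteq> p"
      using p(2) by blast
  qed
  then show "p \<in> \<Inter>\<C>"
    by blast
qed

text \<open>Compactness for chains. The filters \<open>\<Inter>A\<close> also form a chain, so a
  finite part of their union lies in one of them and has nonempty intersection. An ultrafilter above
  the union lies in every \<open>A\<close> by closedness.\<close>

lemma uf_closed_chain_Inter_nonempty:
  assumes "\<C> \<noteq> {}" and closed: "\<And>A. A \<in> \<C> \<Longrightarrow> uf_closed S A \<and> A \<noteq> {}"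
    and chain: "\<And>A B. A \<in> \<C> \<Longrightarrow> B \<in> \<C> \<Longrightarrow> A \<subseteq> B \<or> B \<subseteq> A"
  shows "\<Inter>\<C> \<noteq> {}"
proof -
  define \<F> where "\<F> = Inter ` \<C>"
  have "subset.chain UNIV \<F>"
    unfolding subset_chain_def \<F>_def using chain Inter_anti_mono by (smt (verit) imageE subset_UNIV)
  have "\<Inter>A \<subseteq> Pow S" if A: "A \<in> \<C>" for A
  proof -
    obtain p where "p \<in> A"
      using closed[OF A] by blast
    then show ?thesis
      using closed[OF A] uf_closed_subset ultrafilter_subset by blast
  qed
  then have "\<Union>\<F> \<subseteq> Pow S"
    unfolding \<F>_def by blast
  moreover have "S \<inter> \<Inter>F \<noteq> {}" if F: "finite F" "F \<subseteq> \<Union>\<F>" for F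
  proof -
    have "\<F> \<noteq> {}"
      using assms(1) by (simp add: \<F>_def)
    then obtain H where "H \<in> \<F>" "F \<subseteq> H"
      using finite_subset_Union_chain[OF F _ \<open>subset.chain UNIV \<F>\<close>] by blast
    then obtain A p where "A \<in> \<C>" "p \<in> A" "F \<subseteq> p"
      using closed unfolding \<F>_def by blast
    then have "p \<in> ultrafilters S"
      using closed uf_closed_subset by blast
    then show ?thesis
      using ultrafilter_Inter[OF _ F(1) \<open>F \<subseteq> p\<close>] ultrafilter_empty by metis
  qed
  ultimately obtain p where p: "p \<in> ultrafilters S" "\<Union>\<F> \<subseteq> p"
    by (rule ultrafilter_exists)
  have "p \<in> A" if "A \<in> \<C>" for A
    using uf_closedD[of S A p] closed[OF that] p that unfolding \<F>_def by blast
  then show ?thesis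
    by blast
qed

text \<open>Zorn's lemma for reverse inclusion, with compactness supplying the bounds. The property
  \<open>Q\<close> is left open so that the same argument yields both minimal closed subsemigroups
  and minimal closed left ideals.\<close>

lemma uf_closed_minimal:
  assumes "uf_closed S A" "A \<noteq> {}" "Q A"
    and Q: "\<And>\<C>. \<C> \<noteq> {} \<Longrightarrow> (\<And>B. B \<in> \<C> \<Longrightarrow> Q B) \<Longrightarrow> Q (\<Inter>\<C>)"
  obtains M where "uf_closed S M" "M \<noteq> {}" "Q M" "M \<subseteq> A"
    "\<forall>N. uf_closed S N \<longrightarrow> N \<noteq> {} \<longrightarrow> Q N \<longrightarrow> N \<subseteq> M \<longrightarrow> N = M"
proof -
  define \<A> where "\<A> = {B. uf_closed S B \<and> B \<noteq> {} \<and> Q B \<and> B \<subseteq> A}"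
  have "\<exists>M\<in>\<A>. \<forall>N\<in>\<A>. M \<supseteq> N \<longrightarrow> N = M"
  proof (rule predicate_Zorn)
    show "partial_order_on \<A> (relation_of (\<supseteq>) \<A>)"
      by (rule partial_order_on_relation_ofI) auto
  next
    fix \<C> assume C: "\<C> \<in> Chains (relation_of (\<supseteq>) \<A>)"
    then have CA: "\<C> \<subseteq> \<A>"
      by (rule Chains_relation_of)
    show "\<exists>U\<in>\<A>. \<forall>B\<in>\<C>. B \<supseteq> U"
    proof (cases "\<C> = {}")
      case True
      then show ?thesis
        using assms unfolding \<A>_def by blast
    next
      case False
      have "\<Inter>\<C> \<noteq> {}"
      proof (rule uf_closed_chain_Inter_nonempty[OF False])
        show "uf_closed S B \<and> B \<noteq> {}" if "B \<in> \<C>" for B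
          using that CA unfolding \<A>_def by blast
        show "B \<subseteq> B' \<or> B' \<subseteq> B" if "B \<in> \<C>" "B' \<in> \<C>" for B B'
          using that C unfolding Chains_def relation_of_def by blast
      qed
      moreover have "uf_closed S (\<Inter>\<C>)" "Q (\<Inter>\<C>)" "\<Inter>\<C> \<subseteq> A"
        using False CA unfolding \<A>_def by (blast intro: uf_closed_Inter Q)+
      ultimately show ?thesis
        unfolding \<A>_def by blast
    qed
  qed
  then obtain M where "M \<in> \<A>" "\<And>N. N \<in> \<A> \<Longrightarrow> N \<subseteq> M \<Longrightarrow> N = M"
    by blast
  then show thesis
    using that[of M] unfolding \<A>_def mem_Collect_eq by (meson subset_trans)
qed

section \<open>The semigroup of ultrafilters on an additive semigroup of reals\<close>

locale real_add_semigroup =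
  fixes S :: "real set"
  assumes add_closed: "x \<in> S \<Longrightarrow> y \<in> S \<Longrightarrow> x + y \<in> S"
begin

abbreviation uf_add :: "real set set \<Rightarrow> real set set \<Rightarrow> real set set" (infixl "\<oplus>" 65) where
  "p \<oplus> q \<equiv> uplus S p q"

text \<open>The set of \<open>x\<close> with \<open>-x + P\<close> in \<open>q\<close>. For fixed
  ultrafilter \<open>q\<close> it is a Boolean homomorphism in \<open>P\<close>, and
  \<open>p \<oplus> q\<close> is the preimage of \<open>p\<close> under it, so the ultrafilter
  axioms transfer.\<close>

definition shift :: "real set set \<Rightarrow> real set \<Rightarrow> real set" where
  "shift q P = {x\<in>S. {y\<in>S. x + y \<in> P} \<in> q}"

lemma shift_subset: "shift q P \<subseteq> S"
  by (auto simp: shift_def)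

lemma mem_uplus_iff: "P \<in> p \<oplus> q \<longleftrightarrow> P \<subseteq> S \<and> shift q P \<in> p"
  by (simp add: uplus_def shift_def)

lemma shift_empty: "q \<in> ultrafilters S \<Longrightarrow> shift q {} = {}"
  by (simp add: shift_def ultrafilter_empty)

lemma shift_space: "q \<in> ultrafilters S \<Longrightarrow> shift q S = S"
proof -
  assume "q \<in> ultrafilters S"
  moreover have "{y\<in>S. x + y \<in> S} = S" if "x \<in> S" for x
    using add_closed that by auto
  ultimately show ?thesis
    by (auto simp: shift_def ultrafilter_space)
qed

lemma shift_Int:
  assumes "q \<in> ultrafilters S"
  shows "shift q (P \<inter> Q) = shift q P \<inter> shift q Q"
proof -
  have "{y\<in>S. x + y \<in> P \<inter> Q} \<in> q \<longleftrightarrow> {y\<in>S. x + y \<in> P} \<in> q \<and> {y\<in>S. x + y \<in> Q} \<in> q" for x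
  proof -
    have "{y\<in>S. x + y \<in> P \<inter> Q} = {y\<in>S. x + y \<in> P} \<inter> {y\<in>S. x + y \<in> Q}"
      by auto
    then show ?thesis
      using ultrafilter_Int_iff[OF assms, of "{y\<in>S. x + y \<in> P}" "{y\<in>S. x + y \<in> Q}"] by simp
  qed
  then show ?thesis
    by (auto simp: shift_def)
qed

lemma shift_Diff:
  assumes "q \<in> ultrafilters S"
  shows "shift q (S - P) = S - shift q P"
proof -
  have "{y\<in>S. x + y \<in> S - P} \<in> q \<longleftrightarrow> {y\<in>S. x + y \<in> P} \<notin> q" if "x \<in> S" for x
  proof -
    have "{y\<in>S. x + y \<in> S - P} = S - {y\<in>S. x + y \<in> P}"
      using add_closed that by auto
    then show ?thesis
      using ultrafilter_Diff_iff[OF assms, of "{y\<in>S. x + y \<in> P}"] by auto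
  qed
  then show ?thesis
    by (auto simp: shift_def)
qed

lemma shift_mono:
  assumes "q \<in> ultrafilters S" "P \<subseteq> Q"
  shows "shift q P \<subseteq> shift q Q"
  using shift_Int[OF assms(1), of P Q] assms(2) by (metis inf.absorb_iff1 inf.absorb1)

lemma uplus_ultrafilter:
  assumes p: "p \<in> ultrafilters S" and q: "q \<in> ultrafilters S"
  shows "p \<oplus> q \<in> ultrafilters S"
  unfolding ultrafilters_def
proof (intro CollectI conjI allI impI)
  show "p \<oplus> q \<subseteq> Pow S"
    by (auto simp: mem_uplus_iff)
  show "S \<in> p \<oplus> q"
    using p q by (simp add: mem_uplus_iff shift_space ultrafilter_space)
  show "{} \<notin> p \<oplus> q"
    using p q by (simp add: mem_uplus_iff shift_empty ultrafilter_empty)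
  show "P \<inter> Q \<in> p \<oplus> q" if "P \<in> p \<oplus> q" "Q \<in> p \<oplus> q" for P Q
    using that p q by (auto simp: mem_uplus_iff shift_Int ultrafilter_Int)
  show "Q \<in> p \<oplus> q" if "P \<in> p \<oplus> q" "P \<subseteq> Q" "Q \<subseteq> S" for P Q
    using that p q ultrafilter_mono[OF p _ shift_mono[OF q] shift_subset]
    by (auto simp: mem_uplus_iff)
  show "P \<in> p \<oplus> q \<or> S - P \<in> p \<oplus> q" if "P \<subseteq> S" for P
    using that p q ultrafilter_Diff_iff[OF p shift_subset]
    by (auto simp: mem_uplus_iff shift_Diff)
qed

text \<open>Addition of ultrafilters becomes composition of shifts, which makes associativity
  immediate.\<close>

lemma shift_uplus: "shift (p \<oplus> q) P = shift p (shift q P)"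
proof -
  have "shift q {y\<in>S. x + y \<in> P} = {y\<in>S. x + y \<in> shift q P}" if "x \<in> S" for x
  proof -
    have "{z\<in>S. y + z \<in> {y\<in>S. x + y \<in> P}} = {z\<in>S. x + y + z \<in> P}" if "y \<in> S" for y
      using add_closed that by (auto simp: add.assoc)
    then show ?thesis
      using add_closed \<open>x \<in> S\<close> by (auto simp: shift_def)
  qed
  then show ?thesis
    unfolding shift_def[of "p \<oplus> q"] shift_def[of p] by (auto simp: mem_uplus_iff)
qed

lemma uplus_assoc: "p \<oplus> q \<oplus> r = p \<oplus> (q \<oplus> r)"
  by (auto simp: mem_uplus_iff shift_uplus shift_subset)

text \<open>Right translations are continuous maps of a compact space, hence closed.\<close>

lemma uf_closed_uplus_image:
  assumes A: "uf_closed S A" and q: "q \<in> ultrafilters S"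
  shows "uf_closed S ((\<lambda>p. p \<oplus> q) ` A)"
proof (rule uf_closedI)
  show "(\<lambda>p. p \<oplus> q) ` A \<subseteq> ultrafilters S"
    using uplus_ultrafilter q uf_closed_subset[OF A] by blast
next
  fix p assume p: "p \<in> ultrafilters S" "p \<notin> (\<lambda>p. p \<oplus> q) ` A"
  show "\<exists>P\<in>p. \<forall>r\<in>(\<lambda>p. p \<oplus> q) ` A. P \<notin> r"
  proof (rule ccontr)
    assume "\<not> ?thesis"
    then have "\<exists>a\<in>A. P \<in> a \<oplus> q" if "P \<in> p" for P
      using that by blast
    then have hit: "\<exists>a\<in>A. shift q P \<in> a" if "P \<in> p" for P
      using that by (simp add: mem_uplus_iff)
    \<comment> \<open>An ultrafilter containing \<open>\<Inter>A\<close> lies in \<open>A\<close>,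
      and one containing \<open>shift q\<close> + "" applied to each member of \<open>p\<close> has
      a translate by \<open>q\<close> that includes \<open>p\<close>; one above \<open>G\<close>
      therefore contradicts the choice of \<open>p\<close>.\<close>
    define G where "G = \<Inter>A \<union> shift q ` p"
    have "A \<noteq> {}"
      using hit ultrafilter_space[OF p(1)] by blast
    then have "G \<subseteq> Pow S"
      unfolding G_def using uf_closed_subset[OF A] ultrafilter_subset shift_subset by blast
    moreover have "S \<inter> \<Inter>F \<noteq> {}" if F: "finite F" "F \<subseteq> G" for F
    proof -
      have "finite (F - \<Inter>A)" "F - \<Inter>A \<subseteq> shift q ` p"
        using F unfolding G_def by auto
      then obtain F' where F': "F' \<subseteq> p" "finite F'" "F - \<Inter>A = shift q ` F'"
        by (meson finite_subset_image)
      \<comment> \<open>The finitely many shifted sets in \<open>F\<close> come from finitely many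
        members of \<open>p\<close>; shifting their intersection puts all of them into a single
        \<open>a\<close> of \<open>A\<close>.\<close>
      have "S \<inter> \<Inter>F' \<in> p"
        using ultrafilter_Inter[OF p(1)] F' by blast
      then obtain a where a: "a \<in> A" "shift q (S \<inter> \<Inter>F') \<in> a"
        using hit by blast
      have ua: "a \<in> ultrafilters S"
        using a(1) uf_closed_subset[OF A] by blast
      have "F \<subseteq> a"
      proof
        fix X assume X: "X \<in> F"
        show "X \<in> a"
        proof (cases "X \<in> \<Inter>A")
          case True
          then show ?thesis
            using a(1) by blast
        next
          case False
          then obtain P where P: "P \<in> F'" "X = shift q P"
            using F'(3) X by blast
          then have "shift q (S \<inter> \<Inter>F') \<subseteq> X"
            using shift_mono[OF q, of "S \<inter> \<Inter>F'" P] by blast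
          then show ?thesis
            using ultrafilter_mono[OF ua a(2)] P(2) shift_subset by blast
        qed
      qed
      then have "S \<inter> \<Inter>F \<in> a"
        using ultrafilter_Inter[OF ua F(1)] by blast
      then show ?thesis
        using ultrafilter_empty[OF ua] by metis
    qed
    ultimately obtain a where a: "a \<in> ultrafilters S" "G \<subseteq> a"
      by (rule ultrafilter_exists)
    then have "a \<in> A"
      using uf_closedD[OF A] unfolding G_def by blast
    have "p \<subseteq> a \<oplus> q"
      using a(2) ultrafilter_subset[OF p(1)] unfolding G_def by (auto simp: mem_uplus_iff)
    then have "p = a \<oplus> q"
      by (intro ultrafilter_maximal[OF p(1) uplus_ultrafilter[OF a(1) q]])
    then show False
      using p(2) \<open>a \<in> A\<close> by blast
  qed
qed

text \<open>A fibre of a continuous map over one point. For a limit \<open>p\<close> only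
  \<open>r \<subseteq> p \<oplus> q\<close> has to be checked, by maximality of
  ultrafilters.\<close>

lemma uf_closed_uplus_vimage:
  assumes A: "uf_closed S A" and q: "q \<in> ultrafilters S" and r: "r \<in> ultrafilters S"
  shows "uf_closed S {p\<in>A. p \<oplus> q = r}"
  unfolding uf_closed_def
proof (intro conjI ballI impI)
  show "{p\<in>A. p \<oplus> q = r} \<subseteq> ultrafilters S"
    using uf_closed_subset[OF A] by blast
next
  fix p assume p: "p \<in> ultrafilters S" "\<Inter>{p\<in>A. p \<oplus> q = r} \<subseteq> p"
  have "\<Inter>A \<subseteq> \<Inter>{p\<in>A. p \<oplus> q = r}"
    by blast
  then have "p \<in> A"
    using uf_closedD[OF A p(1)] p(2) by blast
  moreover have "r \<subseteq> p \<oplus> q"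
  proof
    fix P assume "P \<in> r"
    then have "shift q P \<in> a" if "a \<in> A" "a \<oplus> q = r" for a
      using that mem_uplus_iff by blast
    then have "shift q P \<in> p"
      using p(2) by blast
    then show "P \<in> p \<oplus> q"
      using ultrafilter_subset[OF r \<open>P \<in> r\<close>] by (simp add: mem_uplus_iff)
  qed
  then have "r = p \<oplus> q"
    by (intro ultrafilter_maximal[OF r uplus_ultrafilter[OF p(1) q]])
  ultimately show "p \<in> {p\<in>A. p \<oplus> q = r}"
    by blast
qed

section \<open>Idempotents and the smallest ideal\<close>

text \<open>Take a minimal closed subsemigroup \<open>M\<close> and \<open>e\<close> in it. Then
  \<open>M \<oplus> e\<close> is a closed subsemigroup inside \<open>M\<close>, so it equals
  \<open>M\<close> and contains \<open>e\<close>. Hence the stabilizer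
  \<open>{p\<in>M. p \<oplus> e = e}\<close> is nonempty, closed and a subsemigroup, so it is all of
  \<open>M\<close> and contains \<open>e\<close>.\<close>

theorem Ellis_idempotent:
  assumes "uf_closed S A" "A \<noteq> {}" "\<And>p q. p \<in> A \<Longrightarrow> q \<in> A \<Longrightarrow> p \<oplus> q \<in> A"
  obtains e where "e \<in> A" "e \<oplus> e = e"
proof -
  define Q where "Q B \<longleftrightarrow> (\<forall>p\<in>B. \<forall>q\<in>B. p \<oplus> q \<in> B)" for B
  have "Q A"
    using assms(3) by (simp add: Q_def)
  have Q_Inter: "Q (\<Inter>\<C>)" if "\<C> \<noteq> {}" "\<And>B. B \<in> \<C> \<Longrightarrow> Q B" for \<C>
    using that unfolding Q_def by blast
  obtain M where M: "uf_closed S M" "M \<noteq> {}" "Q M" "M \<subseteq> A"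
    and min: "\<forall>N. uf_closed S N \<longrightarrow> N \<noteq> {} \<longrightarrow> Q N \<longrightarrow> N \<subseteq> M \<longrightarrow> N = M"
    by (rule uf_closed_minimal[of S A Q, OF assms(1,2) \<open>Q A\<close> Q_Inter])
  obtain e where e: "e \<in> M"
    using M(2) by blast
  then have ue: "e \<in> ultrafilters S"
    using uf_closed_subset[OF M(1)] by blast
  have "(\<lambda>p. p \<oplus> e) ` M = M"
  proof (rule min[rule_format])
    show "Q ((\<lambda>p. p \<oplus> e) ` M)"
      unfolding Q_def
    proof (intro ballI)
      fix p q assume "p \<in> (\<lambda>p. p \<oplus> e) ` M" "q \<in> (\<lambda>p. p \<oplus> e) ` M"
      then obtain a b where "a \<in> M" "b \<in> M" "p = a \<oplus> e" "q = b \<oplus> e"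
        by blast
      then have "p \<oplus> q = a \<oplus> e \<oplus> b \<oplus> e" "a \<oplus> e \<oplus> b \<in> M"
        using M(3) e unfolding Q_def by (simp_all add: uplus_assoc)
      then show "p \<oplus> q \<in> (\<lambda>p. p \<oplus> e) ` M"
        by blast
    qed
    show "(\<lambda>p. p \<oplus> e) ` M \<subseteq> M"
      using M(3) e unfolding Q_def by blast
  qed (use M uf_closed_uplus_image ue in auto)
  have "{p\<in>M. p \<oplus> e = e} = M"
  proof (rule min[rule_format])
    show "uf_closed S {p\<in>M. p \<oplus> e = e}"
      by (rule uf_closed_uplus_vimage[OF M(1) ue ue])
    have "e \<in> (\<lambda>p. p \<oplus> e) ` M"
      using e \<open>(\<lambda>p. p \<oplus> e) ` M = M\<close> by simp
    then show "{p\<in>M. p \<oplus> e = e} \<noteq> {}"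
      by auto
    show "Q {p\<in>M. p \<oplus> e = e}"
      using M(3) unfolding Q_def by (simp add: uplus_assoc)
  qed blast
  then show thesis
    using that e M(4) by blast
qed

text \<open>
  The union of the minimal left ideals is a two-sided ideal; its members are those \<open>q\<close>
  that lie in the left ideal generated by every element of \<open>T \<oplus> q\<close>.
\<close>

lemma smallest_ideal_uplus:
  assumes T: "uf_closed S T" "\<And>p q. p \<in> T \<Longrightarrow> q \<in> T \<Longrightarrow> p \<oplus> q \<in> T"
    and "T \<noteq> {}" and q: "q \<in> smallest_ideal (uplus S) T"
    and "t \<in> T"
  shows "\<exists>x\<in>T. q = x \<oplus> (t \<oplus> q)"
proof -
  define J where "J = {q\<in>T. \<forall>t\<in>T. \<exists>x\<in>T. q = x \<oplus> (t \<oplus> q)}"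
  define Q where "Q B \<longleftrightarrow> B \<subseteq> T \<and> (\<forall>t\<in>T. \<forall>p\<in>B. t \<oplus> p \<in> B)" for B
  have "Q T"
    using T(2) by (simp add: Q_def)
  have Q_Inter: "Q (\<Inter>\<C>)" if "\<C> \<noteq> {}" "\<And>B. B \<in> \<C> \<Longrightarrow> Q B" for \<C>
    using that unfolding Q_def by blast
  obtain L where L: "uf_closed S L" "L \<noteq> {}" "Q L" "L \<subseteq> T"
    and min: "\<forall>N. uf_closed S N \<longrightarrow> N \<noteq> {} \<longrightarrow> Q N \<longrightarrow> N \<subseteq> L \<longrightarrow> N = L"
    by (rule uf_closed_minimal[of S T Q, OF T(1) \<open>T \<noteq> {}\<close> \<open>Q T\<close> Q_Inter])
  \<comment> \<open>\<open>T \<oplus> r\<close> is a closed left ideal inside \<open>L\<close>, so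
    minimality makes every element of \<open>L\<close> generate \<open>L\<close>. This puts
    \<open>L\<close> inside \<open>J\<close>, which is therefore nonempty.\<close>
  have L_gen: "(\<lambda>x. x \<oplus> r) ` T = L" if "r \<in> L" for r
  proof (rule min[rule_format])
    have "r \<in> ultrafilters S"
      using that uf_closed_subset[OF L(1)] by blast
    then show "uf_closed S ((\<lambda>x. x \<oplus> r) ` T)"
      by (rule uf_closed_uplus_image[OF T(1)])
    show "Q ((\<lambda>x. x \<oplus> r) ` T)"
      using that L(3,4) T(2) unfolding Q_def by (auto simp flip: uplus_assoc)
  qed (use that L(3) \<open>T \<noteq> {}\<close> in \<open>auto simp: Q_def\<close>)
  have "L \<subseteq> J"
  proof
    fix p assume p: "p \<in> L"
    have "\<exists>x\<in>T. p = x \<oplus> (t \<oplus> p)" if "t \<in> T" for t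
    proof -
      have "t \<oplus> p \<in> L"
        using L(3) p that unfolding Q_def by blast
      then have "p \<in> (\<lambda>x. x \<oplus> (t \<oplus> p)) ` T"
        using L_gen p by simp
      then show ?thesis
        by blast
    qed
    then show "p \<in> J"
      using p L(4) unfolding J_def by blast
  qed
  have "left_ideal (uplus S) T J"
    unfolding left_ideal_def
  proof (intro conjI ballI)
    show "J \<noteq> {}" "J \<subseteq> T"
      using \<open>L \<subseteq> J\<close> L(2) by (auto simp: J_def)
    fix t p assume t: "t \<in> T" and p: "p \<in> J"
    have "\<exists>x\<in>T. t \<oplus> p = x \<oplus> (s \<oplus> (t \<oplus> p))" if s: "s \<in> T" for s
    proof -
      \<comment> \<open>The defining condition of \<open>J\<close> is applied to
        \<open>s \<oplus> t\<close> instead of \<open>t\<close>; adding \<open>t\<close> on the left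
        then recovers \<open>t \<oplus> p\<close>.\<close>
      obtain x where "x \<in> T" "p = x \<oplus> (s \<oplus> t \<oplus> p)"
        using p T(2)[OF s t] unfolding J_def by blast
      then have "t \<oplus> p = t \<oplus> x \<oplus> (s \<oplus> (t \<oplus> p))"
        by (metis uplus_assoc)
      then show ?thesis
        using T(2)[OF t \<open>x \<in> T\<close>] by blast
    qed
    then show "t \<oplus> p \<in> J"
      using p t T(2) unfolding J_def by blast
  qed
  moreover have "right_ideal (uplus S) T J"
    unfolding right_ideal_def
  proof (intro conjI ballI)
    show "J \<noteq> {}" "J \<subseteq> T"
      using \<open>L \<subseteq> J\<close> L(2) by (auto simp: J_def)
    fix p t assume p: "p \<in> J" and t: "t \<in> T"
    have "\<exists>x\<in>T. p \<oplus> t = x \<oplus> (s \<oplus> (p \<oplus> t))" if s: "s \<in> T" for s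
    proof -
      obtain x where "x \<in> T" "p = x \<oplus> (s \<oplus> p)"
        using p s unfolding J_def by blast
      then show ?thesis
        by (metis uplus_assoc)
    qed
    then show "p \<oplus> t \<in> J"
      using p t T(2) unfolding J_def by blast
  qed
  ultimately have "q \<in> J"
    using q unfolding smallest_ideal_def by blast
  then show ?thesis
    using \<open>t \<in> T\<close> unfolding J_def by blast
qed

text \<open>
  An idempotent \<open>e\<close> of \<open>T \<oplus> r\<close> lies in the minimal left ideal of \<open>U\<close> containing \<open>q\<close>,
  so it is a right identity for \<open>q\<close>; therefore \<open>q = q \<oplus> e \<in> T \<oplus> r\<close>.
\<close>

lemma smallest_ideal_left_ideal_subsemigroup:
  assumes U: "uf_closed S U" "\<And>p q. p \<in> U \<Longrightarrow> q \<in> U \<Longrightarrow> p \<oplus> q \<in> U"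
    and T: "uf_closed S T" "\<And>p q. p \<in> T \<Longrightarrow> q \<in> T \<Longrightarrow> p \<oplus> q \<in> T" "T \<subseteq> U"
    and q: "q \<in> T" "q \<in> smallest_ideal (uplus S) U"
    and r: "r \<in> (\<lambda>t. t \<oplus> q) ` T"
  obtains s where "s \<in> T" "q = s \<oplus> r"
proof -
  obtain t where t: "t \<in> T" "r = t \<oplus> q"
    using r by blast
  then have rT: "r \<in> T"
    using T(2) q(1) by blast
  then have "r \<in> ultrafilters S"
    using uf_closed_subset[OF T(1)] by blast
  then have "uf_closed S ((\<lambda>x. x \<oplus> r) ` T)"
    by (rule uf_closed_uplus_image[OF T(1)])
  moreover have "x \<oplus> y \<in> (\<lambda>x. x \<oplus> r) ` T"
    if "x \<in> (\<lambda>x. x \<oplus> r) ` T" "y \<in> (\<lambda>x. x \<oplus> r) ` T" for x y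
    using that T(2) rT by (auto simp flip: uplus_assoc)
  ultimately obtain e where e: "e \<in> (\<lambda>x. x \<oplus> r) ` T" "e \<oplus> e = e"
    using Ellis_idempotent[of "(\<lambda>x. x \<oplus> r) ` T"] rT by blast
  then obtain y where y: "y \<in> T" "e = y \<oplus> r"
    by blast
  then have "e = y \<oplus> t \<oplus> q" "y \<oplus> t \<in> U"
    using t T(2,3) by (auto simp: uplus_assoc)
  then obtain x where "q = x \<oplus> e"
    using smallest_ideal_uplus[OF U _ q(2)] q(1) T(3) by blast
  \<comment> \<open>From \<open>q = x \<oplus> e\<close> and idempotence,
    \<open>q \<oplus> e = q\<close>; with \<open>e = y \<oplus> r\<close> the required element is
    \<open>s = q \<oplus> y\<close>.\<close>
  then have "q = q \<oplus> y \<oplus> r"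
    using e(2) y(2) by (metis uplus_assoc)
  then show thesis
    using that T(2) q(1) y(1) by blast
qed

section \<open>The semigroup of ultrafilters near zero\<close>

lemma O_plus_subset: "O_plus S \<subseteq> ultrafilters S"
  by (auto simp: O_plus_def)

lemma uf_closed_O_plus: "uf_closed S (O_plus S)"
proof (rule uf_closedI[OF O_plus_subset])
  fix p assume p: "p \<in> ultrafilters S" "p \<notin> O_plus S"
  then obtain \<epsilon> :: real where \<epsilon>: "\<epsilon> > 0" "{0<..<\<epsilon>} \<inter> S \<notin> p"
    by (auto simp: O_plus_def)
  have "S - {0<..<\<epsilon>} \<inter> S \<notin> q" if "q \<in> O_plus S" for q
    using that \<epsilon>(1) ultrafilter_Diff_iff[of q S "{0<..<\<epsilon>} \<inter> S"] by (simp add: O_plus_def)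
  moreover have "S - {0<..<\<epsilon>} \<inter> S \<in> p"
    using \<epsilon>(2) ultrafilter_Diff_iff[OF p(1), of "{0<..<\<epsilon>} \<inter> S"] by simp
  ultimately show "\<exists>P\<in>p. \<forall>q\<in>O_plus S. P \<notin> q"
    by blast
qed

lemma O_plus_uplus:
  assumes "p \<in> O_plus S" "q \<in> O_plus S"
  shows "p \<oplus> q \<in> O_plus S"
proof -
  have p: "p \<in> ultrafilters S" and q: "q \<in> ultrafilters S"
    using assms O_plus_subset by blast+
  have "{0<..<\<epsilon>} \<inter> S \<in> p \<oplus> q" if "\<epsilon> > 0" for \<epsilon>
  proof -
    have half: "{0<..<\<epsilon>/2} \<inter> S \<in> p" "{0<..<\<epsilon>/2} \<inter> S \<in> q"
      using assms that by (simp_all add: O_plus_def)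
    have "{0<..<\<epsilon>/2} \<inter> S \<subseteq> shift q ({0<..<\<epsilon>} \<inter> S)"
    proof
      fix x assume x: "x \<in> {0<..<\<epsilon>/2} \<inter> S"
      then have "{0<..<\<epsilon>/2} \<inter> S \<subseteq> {y\<in>S. x + y \<in> {0<..<\<epsilon>} \<inter> S}"
        using add_closed by auto
      then have "{y\<in>S. x + y \<in> {0<..<\<epsilon>} \<inter> S} \<in> q"
        by (rule ultrafilter_mono[OF q half(2)]) auto
      then show "x \<in> shift q ({0<..<\<epsilon>} \<inter> S)"
        using x by (simp add: shift_def)
    qed
    then have "shift q ({0<..<\<epsilon>} \<inter> S) \<in> p"
      by (rule ultrafilter_mono[OF p half(1) _ shift_subset])
    then show ?thesis
      by (simp add: mem_uplus_iff)
  qed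
  then show ?thesis
    using uplus_ultrafilter[OF p q] by (simp add: O_plus_def)
qed

text \<open>A nonempty \<open>O_plus S\<close> is an ideal of itself and so takes part in the
  intersection. Ideals are nonempty by definition, so an empty semigroup has none and the
  intersection would be the whole type.\<close>

lemma smallest_ideal_O_plus_subset:
  assumes "O_plus S \<noteq> {}"
  shows "smallest_ideal (uplus S) (O_plus S) \<subseteq> O_plus S"
proof -
  have "left_ideal (uplus S) (O_plus S) (O_plus S)" "right_ideal (uplus S) (O_plus S) (O_plus S)"
    using assms by (simp_all add: left_ideal_def right_ideal_def O_plus_uplus)
  then show ?thesis
    by (auto simp: smallest_ideal_def)
qed

text \<open>
  Only the first matrix needs finitely many rows: its image \<open>x\<close> is chosen first, and the image
  of the second one then only has to lie in finitely many translates of \<open>P\<close>.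
\<close>

lemma I_set_uplus_witness:
  assumes "finite (Field (row_ord A))" and p: "p \<in> I_set A S" and q: "q \<in> I_set B S"
    and P: "P \<in> p \<oplus> q"
  obtains x y where "\<forall>j\<in>Field (col_ord A). x j \<in> S" "\<forall>j\<in>Field (col_ord B). y j \<in> S"
    "\<forall>i\<in>Field (row_ord A). \<forall>k\<in>Field (row_ord B). mat_vec A x i + mat_vec B y k \<in> P"
proof -
  have "shift q P \<in> p"
    using P by (simp add: mem_uplus_iff)
  then obtain x where x: "\<forall>j\<in>Field (col_ord A). x j \<in> S"
    "\<forall>i\<in>Field (row_ord A). mat_vec A x i \<in> shift q P"
    using p unfolding I_set_def by blast
  have "{y\<in>S. mat_vec A x i + y \<in> P} \<in> q" if "i \<in> Field (row_ord A)" for i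
    using x(2) that by (simp add: shift_def)
  then have "{y\<in>S. \<forall>i\<in>Field (row_ord A). mat_vec A x i + y \<in> P} \<in> q"
    using q assms(1) by (intro ultrafilter_INT) (simp_all add: I_set_def)
  then obtain y where "\<forall>j\<in>Field (col_ord B). y j \<in> S"
    "\<forall>k\<in>Field (row_ord B). mat_vec B y k \<in> {y\<in>S. \<forall>i\<in>Field (row_ord A). mat_vec A x i + y \<in> P}"
    using q unfolding I_set_def by blast
  then show thesis
    using that[of x y] x(1) by blast
qed

end

section \<open>Ultrafilters whose members contain images of a matrix\<close>

lemma I_set_subset: "I_set A S \<subseteq> ultrafilters S"
  by (auto simp: I_set_def)

text \<open>Failure to belong to \<open>I_set A S\<close> is witnessed by a single \<open>P\<close>,
  which excludes every ultrafilter containing it.\<close>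

lemma uf_closed_I_set: "uf_closed S (I_set A S)"
proof (rule uf_closedI[OF I_set_subset])
  fix p assume "p \<in> ultrafilters S" "p \<notin> I_set A S"
  then obtain P where "P \<in> p" "\<not> (\<exists>x. (\<forall>j\<in>Field (col_ord A). x j \<in> S) \<and>
      (\<forall>i\<in>Field (row_ord A). mat_vec A x i \<in> P))"
    unfolding I_set_def by blast
  then show "\<exists>P\<in>p. \<forall>q\<in>I_set A S. P \<notin> q"
    unfolding I_set_def by blast
qed

text \<open>If the complement of \<open>(0, \<epsilon>)\<close> were in \<open>p\<close>, it would
  have to contain image entries below \<open>\<epsilon>\<close>, which is contradictory as soon as
  there is a row. Conversely, \<open>P\<close> may be intersected with
  \<open>(0, \<epsilon>)\<close> first.\<close>

lemma I0_set_eq: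
  assumes "Field (row_ord A) \<noteq> {}"
  shows "I0_set A S = I_set A S \<inter> O_plus S"
proof (intro equalityI subsetI)
  fix p assume p: "p \<in> I0_set A S"
  then have u: "p \<in> ultrafilters S"
    by (simp add: I0_set_def)
  have small: "\<exists>x. (\<forall>j\<in>Field (col_ord A). x j \<in> S) \<and>
      (\<forall>i\<in>Field (row_ord A). mat_vec A x i \<in> P \<inter> {0<..<\<epsilon>})" if "P \<in> p" "\<epsilon> > 0" for P and \<epsilon> :: real
    using p that unfolding I0_set_def by simp
  have "{0<..<\<epsilon>} \<inter> S \<in> p" if "\<epsilon> > 0" for \<epsilon> :: real
  proof (rule ccontr)
    assume "{0<..<\<epsilon>} \<inter> S \<notin> p"
    then have "S - {0<..<\<epsilon>} \<inter> S \<in> p"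
      using ultrafilter_Diff_iff[OF u, of "{0<..<\<epsilon>} \<inter> S"] by simp
    then show False
      using small[OF _ that] assms by fast
  qed
  moreover have "p \<in> I_set A S"
    unfolding I_set_def using u small[OF _ zero_less_one] by blast
  ultimately show "p \<in> I_set A S \<inter> O_plus S"
    using u by (simp add: O_plus_def)
next
  fix p assume p: "p \<in> I_set A S \<inter> O_plus S"
  then have u: "p \<in> ultrafilters S"
    by (simp add: I_set_def)
  have "\<exists>x. (\<forall>j\<in>Field (col_ord A). x j \<in> S) \<and>
      (\<forall>i\<in>Field (row_ord A). mat_vec A x i \<in> P \<inter> {0<..<\<epsilon>})" if "P \<in> p" "\<epsilon> > 0" for P and \<epsilon> :: real
  proof -
    have "{0<..<\<epsilon>} \<inter> S \<in> p"
      using p \<open>\<epsilon> > 0\<close> unfolding O_plus_def by blast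
    then have "P \<inter> ({0<..<\<epsilon>} \<inter> S) \<in> p"
      by (rule ultrafilter_Int[OF u \<open>P \<in> p\<close>])
    then obtain x where "\<forall>j\<in>Field (col_ord A). x j \<in> S"
      "\<forall>i\<in>Field (row_ord A). mat_vec A x i \<in> P \<inter> ({0<..<\<epsilon>} \<inter> S)"
      using p unfolding I_set_def by blast
    then show ?thesis
      by blast
  qed
  then show "p \<in> I0_set A S"
    using u by (simp add: I0_set_def)
qed

lemma O_plus_nonempty:
  assumes "dense_subsemigroup S"
  shows "O_plus S \<noteq> {}"
proof -
  define G where "G = (\<lambda>\<epsilon>::real. {0<..<\<epsilon>} \<inter> S) ` {0<..}"
  have "G \<subseteq> Pow S"
    by (auto simp: G_def)
  moreover have "S \<inter> \<Inter>F \<noteq> {}" if F: "finite F" "F \<subseteq> G" for F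
  proof -
    obtain E where E: "E \<subseteq> {0<..}" "finite E" "F = (\<lambda>\<epsilon>::real. {0<..<\<epsilon>} \<inter> S) ` E"
      using finite_subset_image[OF F[unfolded G_def]] by blast
    \<comment> \<open>The least of the finitely many right ends; inserting 1 keeps the minimum
      meaningful for empty \<open>E\<close>. Density gives a point of \<open>S\<close> at distance
      below \<open>m / 2\<close> from \<open>m / 2\<close>, hence in \<open>(0, m)\<close>.\<close>
    define m where "m = Min (insert 1 E)"
    have m: "m > 0" "\<And>\<epsilon>. \<epsilon> \<in> E \<Longrightarrow> m \<le> \<epsilon>"
      using E(1,2) by (auto simp: m_def subset_iff)
    then have "m / 2 \<in> closure S"
      using assms by (auto simp: dense_subsemigroup_def)
    then obtain s where s: "s \<in> S" "dist s (m / 2) < m / 2"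
      using m(1) unfolding closure_approachable by (meson half_gt_zero)
    then have "0 < s" "s < m"
      unfolding dist_real_def by linarith+
    then have "s \<in> S \<inter> \<Inter>F"
      using s(1) m(2) E(3) by force
    then show ?thesis
      by blast
  qed
  ultimately obtain p where "p \<in> ultrafilters S" "G \<subseteq> p"
    by (rule ultrafilter_exists)
  then have "p \<in> O_plus S"
    by (auto simp: O_plus_def G_def)
  then show ?thesis
    by blast
qed

section \<open>Matrices\<close>

lemma Field_ord_sum: "Field (ord_sum r s) = Inl ` Field r \<union> Inr ` Field s"
  unfolding ord_sum_def Field_def by (auto simp: image_iff)

lemma ord_sum_simps [simp]:
  "(Inl a, Inl a') \<in> ord_sum r s \<longleftrightarrow> (a, a') \<in> r"
  "(Inr b, Inr b') \<in> ord_sum r s \<longleftrightarrow> (b, b') \<in> s"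
  "(Inl a, Inr b) \<in> ord_sum r s \<longleftrightarrow> a \<in> Field r \<and> b \<in> Field s"
  "(Inr b, Inl a) \<notin> ord_sum r s"
  by (auto simp: ord_sum_def)

lemma countable_ordinal_ord_sum:
  assumes "countable_ordinal r" "countable_ordinal s"
  shows "countable_ordinal (ord_sum r s)"
proof -
  have r: "Well_order r" and s: "Well_order s"
    using assms by (simp_all add: countable_ordinal_def)
  then have lin: "Linear_order r" "Linear_order s"
    by (simp_all add: well_order_on_def)
  have "Linear_order (ord_sum r s)"
    unfolding linear_order_on_def partial_order_on_def preorder_on_def
  proof (intro conjI)
    show "ord_sum r s \<subseteq> Field (ord_sum r s) \<times> Field (ord_sum r s)"
      by (auto simp: Field_def)
    show "refl_on (Field (ord_sum r s)) (ord_sum r s)"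
      using lin by (auto simp: Field_ord_sum order_on_defs refl_on_def)
    show "trans (ord_sum r s)"
    proof (rule transI)
      fix x y z assume "(x, y) \<in> ord_sum r s" "(y, z) \<in> ord_sum r s"
      moreover have "trans r" "trans s"
        using lin by (simp_all add: order_on_defs)
      ultimately show "(x, z) \<in> ord_sum r s"
        by (cases x; cases y; cases z) (auto dest: transD intro: FieldI1 FieldI2)
    qed
    show "antisym (ord_sum r s)"
    proof (rule antisymI)
      fix x y assume "(x, y) \<in> ord_sum r s" "(y, x) \<in> ord_sum r s"
      moreover have "antisym r" "antisym s"
        using lin by (simp_all add: order_on_defs)
      ultimately show "x = y"
        by (cases x; cases y) (auto dest: antisymD)
    qed
    show "Total (ord_sum r s)"
    proof (rule total_onI)
      fix x y assume "x \<in> Field (ord_sum r s)" "y \<in> Field (ord_sum r s)" "x \<noteq> y"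
      moreover have "Total r" "Total s"
        using lin by (simp_all add: order_on_defs)
      ultimately show "(x, y) \<in> ord_sum r s \<or> (y, x) \<in> ord_sum r s"
        by (cases x; cases y) (simp_all add: Field_ord_sum total_on_def image_iff)
    qed
  qed
  \<comment> \<open>A least element is sought in the left summand if \<open>X\<close> meets it, and
    in the right one otherwise.\<close>
  moreover have "\<exists>a\<in>X. \<forall>b\<in>X. (a, b) \<in> ord_sum r s" if X: "X \<subseteq> Field (ord_sum r s)" "X \<noteq> {}" for X
  proof (cases "Inl -` X = {}")
    case True
    have "Inr -` X \<subseteq> Field s"
      using X(1) by (auto simp: Field_ord_sum)
    moreover have XR: "X \<subseteq> Inr ` (Inr -` X)"
    proof
      fix x assume "x \<in> X"
      then show "x \<in> Inr ` (Inr -` X)"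
        using True by (cases x) auto
    qed
    then have "Inr -` X \<noteq> {}"
      using X(2) by auto
    ultimately obtain a where "a \<in> Inr -` X" "\<forall>b\<in>Inr -` X. (a, b) \<in> s"
      using s Linear_order_Well_order_iff[OF lin(2)] by meson
    then show ?thesis
      using XR by (intro bexI[of _ "Inr a"]) auto
  next
    case False
    moreover have XL: "Inl -` X \<subseteq> Field r"
      using X(1) by (auto simp: Field_ord_sum)
    ultimately obtain a where "a \<in> Inl -` X" "\<forall>b\<in>Inl -` X. (a, b) \<in> r"
      using r Linear_order_Well_order_iff[OF lin(1)] by meson
    moreover have "(Inl a, b) \<in> ord_sum r s" if "b \<in> X" for b
      using that X(1) XL calculation by (cases b) (auto simp: Field_ord_sum)
    ultimately show ?thesis
      by blast
  qed
  ultimately have "Well_order (ord_sum r s)"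
    by (simp add: Linear_order_Well_order_iff)
  then show ?thesis
    using assms by (simp add: countable_ordinal_def Field_ord_sum)
qed

lemma mat_vec_add: "mat_vec A (\<lambda>j. x j + y j) i = mat_vec A x i + mat_vec A y i"
  by (simp add: mat_vec_def distrib_left sum.distrib)

lemma mat_vec_scale: "mat_vec A (\<lambda>j. c * x j) i = c * mat_vec A x i"
  by (simp add: mat_vec_def sum_distrib_left mult_ac)

text \<open>The witness lemma with \<open>A\<close> in both roles puts all sums
  \<open>mat_vec A x i + mat_vec A y k\<close> into \<open>P\<close>; those with
  \<open>i = k\<close> are the image of \<open>x + y\<close>.\<close>

lemma I0_set_uplus:
  assumes "dense_subsemigroup S" "finite (Field (row_ord A))" "Field (row_ord A) \<noteq> {}"
    and p: "p \<in> I0_set A S" and q: "q \<in> I0_set A S"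
  shows "uplus S p q \<in> I0_set A S"
proof -
  interpret real_add_semigroup S
    using assms(1) by unfold_locales (simp add: dense_subsemigroup_def)
  have p: "p \<in> I_set A S" "p \<in> O_plus S" and q: "q \<in> I_set A S" "q \<in> O_plus S"
    using p q I0_set_eq[OF assms(3), of S] by auto
  have "\<exists>x. (\<forall>j\<in>Field (col_ord A). x j \<in> S) \<and> (\<forall>i\<in>Field (row_ord A). mat_vec A x i \<in> P)"
    if P: "P \<in> uplus S p q" for P
  proof -
    obtain x y where "\<forall>j\<in>Field (col_ord A). x j \<in> S" "\<forall>j\<in>Field (col_ord A). y j \<in> S"
      "\<forall>i\<in>Field (row_ord A). \<forall>k\<in>Field (row_ord A). mat_vec A x i + mat_vec A y k \<in> P"
      by (rule I_set_uplus_witness[OF assms(2) p(1) q(1) P])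
    then show ?thesis
      using add_closed by (intro exI[of _ "\<lambda>j. x j + y j"]) (simp add: mat_vec_add)
  qed
  then have "uplus S p q \<in> I_set A S"
    using uplus_ultrafilter p(1) q(1) unfolding I_set_def by simp
  then show ?thesis
    using O_plus_uplus[OF p(2) q(2)] I0_set_eq[OF assms(3), of S] by simp
qed

section \<open>Images of block matrices\<close>

lemma block_mat_sel [simp]:
  "row_ord (block_mat A B M) = ord_sum (row_ord A) (row_ord M)"
  "col_ord (block_mat A B M) = ord_sum (col_ord A) (ord_sum (col_ord B) (col_ord M))"
  "entry (block_mat A B M) (Inl i) (Inl j) = entry A i j"
  "entry (block_mat A B M) (Inl i) (Inr (Inl j')) = entry B i j'"
  "entry (block_mat A B M) (Inl i) (Inr (Inr j'')) = 0"
  "entry (block_mat A B M) (Inr k) (Inl j) = 0"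
  "entry (block_mat A B M) (Inr k) (Inr (Inl j')) = 0"
  "entry (block_mat A B M) (Inr k) (Inr (Inr j'')) = entry M k j''"
  by (simp_all add: block_mat_def)

lemma row_support_block_mat:
  "row_support (block_mat A B M) (Inl i) =
    Inl ` row_support A i \<union> (Inr \<circ> Inl) ` row_support B i"
  "row_support (block_mat A B M) (Inr k) = (Inr \<circ> Inr) ` row_support M k"
  by (auto simp: row_support_def Field_ord_sum)

lemma mat_vec_block_mat:
  assumes "finite (row_support A i)" "finite (row_support B i)"
  shows "mat_vec (block_mat A B M) (case_sum x (case_sum y z)) (Inl i) = mat_vec A x i + mat_vec B y i"
  unfolding mat_vec_def row_support_block_mat
  by (subst sum.union_disjoint) (auto simp: assms sum.reindex inj_on_def)

lemma mat_vec_block_mat_Inr: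
  "mat_vec (block_mat A B M) (case_sum x (case_sum y z)) (Inr k) = mat_vec M z k"
  unfolding mat_vec_def row_support_block_mat by (simp add: sum.reindex inj_on_def)

section \<open>Diagonal sums of finite image partition regular matrices\<close>

text \<open>The block diagonal matrix with blocks \<open>D\<close> and \<open>E\<close>. Indices are
  shifted natural numbers rather than a disjoint sum, because \<open>finite_ipr\<close> speaks of
  matrices indexed by \<open>nat\<close>.\<close>

definition diag_mat ::
  "nat \<Rightarrow> nat \<Rightarrow> (nat, nat) omat \<Rightarrow> nat \<Rightarrow> nat \<Rightarrow> (nat, nat) omat \<Rightarrow> (nat, nat) omat" where
  "diag_mat u v D u' v' E =
    \<lparr> row_ord = natLeq_on (u + u'), col_ord = natLeq_on (v + v'),
      entry = (\<lambda>i j. if i < u then (if j < v then entry D i j else 0)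
                      else if j < v then 0 else entry E (i - u) (j - v)) \<rparr>"

lemma diag_mat_sel [simp]:
  "row_ord (diag_mat u v D u' v' E) = natLeq_on (u + u')"
  "col_ord (diag_mat u v D u' v' E) = natLeq_on (v + v')"
  by (simp_all add: diag_mat_def)

lemma mat_vec_diag_mat_upper:
  assumes "col_ord D = natLeq_on v" "i < u"
  shows "mat_vec (diag_mat u v D u' v' E) x i = mat_vec D x i"
proof -
  have "row_support (diag_mat u v D u' v' E) i = row_support D i"
    using assms by (auto simp: row_support_def diag_mat_def Field_natLeq_on)
  then show ?thesis
    unfolding mat_vec_def using assms
    by (intro sum.cong) (auto simp: row_support_def diag_mat_def Field_natLeq_on)
qed

lemma mat_vec_diag_mat_lower:
  assumes "col_ord E = natLeq_on v'"
  shows "mat_vec (diag_mat u v D u' v' E) x (u + k) = mat_vec E (\<lambda>j. x (v + j)) k"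
proof -
  have "row_support (diag_mat u v D u' v' E) (u + k) = (+) v ` row_support E k"
  proof (intro equalityI subsetI)
    fix j assume "j \<in> row_support (diag_mat u v D u' v' E) (u + k)"
    then have "v \<le> j" "j - v \<in> row_support E k"
      using assms by (auto simp: row_support_def diag_mat_def Field_natLeq_on split: if_splits)
    then show "j \<in> (+) v ` row_support E k"
      by (metis image_eqI le_add_diff_inverse)
  next
    fix j assume "j \<in> (+) v ` row_support E k"
    then obtain l where "j = v + l" "l \<in> row_support E k"
      by blast
    then show "j \<in> row_support (diag_mat u v D u' v' E) (u + k)"
      using assms by (simp add: row_support_def diag_mat_def Field_natLeq_on)
  qed
  then show ?thesis
    by (simp add: mat_vec_def sum.reindex diag_mat_def)
qed

text \<open>A vector for the diagonal sum splits into one for each block. Since the ultrafilter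
  provided by \<open>N0\<close> depends on the finite matrix, this is how one ultrafilter comes to
  serve \<open>D\<close> and \<open>E\<close> together.\<close>

lemma I_set_diag_mat:
  assumes "is_dim u v D" "is_dim u' v' E"
  shows "I_set (diag_mat u v D u' v' E) S \<subseteq> I_set D S \<inter> I_set E S"
proof
  fix p assume p: "p \<in> I_set (diag_mat u v D u' v' E) S"
  have "(\<exists>x. (\<forall>j<v. x j \<in> S) \<and> (\<forall>i<u. mat_vec D x i \<in> P)) \<and>
    (\<exists>y. (\<forall>j<v'. y j \<in> S) \<and> (\<forall>i<u'. mat_vec E y i \<in> P))" if "P \<in> p" for P
  proof -
    have "\<exists>x. (\<forall>j<v+v'. x j \<in> S) \<and> (\<forall>i<u+u'. mat_vec (diag_mat u v D u' v' E) x i \<in> P)"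
      using p that unfolding I_set_def by (simp add: Field_natLeq_on)
    then obtain x where "\<forall>j<v+v'. x j \<in> S" "\<forall>i<u+u'. mat_vec (diag_mat u v D u' v' E) x i \<in> P"
      by blast
    then have "\<forall>j<v. x j \<in> S" "\<forall>i<u. mat_vec D x i \<in> P"
      and "\<forall>j<v'. x (v + j) \<in> S" "\<forall>i<u'. mat_vec E (\<lambda>j. x (v + j)) i \<in> P"
      using assms mat_vec_diag_mat_upper[of D v _ u u' v' E x] mat_vec_diag_mat_lower[of E v' u v D u' x]
      unfolding is_dim_def by (metis add_strict_left_mono trans_less_add1)+
    then show ?thesis
      by (intro conjI exI[of _ x] exI[of _ "\<lambda>j. x (v + j)"])
  qed
  then show "p \<in> I_set D S \<inter> I_set E S"
    using p assms unfolding I_set_def is_dim_def by (simp add: Field_natLeq_on)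
qed

text \<open>The vector \<open>a\<close> holds the entries of the image as natural numbers, since
  \<open>mat_vec\<close> is real valued.\<close>

definition represents_in :: "nat \<Rightarrow> nat \<Rightarrow> (nat, nat) omat \<Rightarrow> nat set \<Rightarrow> bool" where
  "represents_in u v D P \<longleftrightarrow>
    (\<exists>x a. (\<forall>j<v. 0 < x j) \<and> (\<forall>i<u. a i \<in> P \<and> mat_vec D (\<lambda>j. real (x j)) i = real (a i)))"

lemma image_partition_regularD:
  fixes c :: "nat \<Rightarrow> nat"
  assumes "image_partition_regular u v D" "\<forall>n>0. c n < k"
  shows "\<exists>x. (\<forall>j<v. 0 < x j) \<and>
    (\<exists>m. \<forall>i<u. \<exists>n>0. mat_vec D (\<lambda>j. real (x j)) i = real n \<and> c n = m)"
  using assms by (simp add: image_partition_regular_def)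

text \<open>Complements of sets without an image of \<open>D\<close> have the finite intersection
  property: otherwise finitely many such sets would cover the positive integers, and the resulting
  colouring would contradict partition regularity.\<close>

lemma image_partition_regular_ultrafilter:
  assumes "image_partition_regular u v D"
  obtains p where "p \<in> ultrafilters {0<..}" "\<And>P. P \<in> p \<Longrightarrow> represents_in u v D P"
proof -
  define G where "G = {{0<..} - P |P. \<not> represents_in u v D P}"
  have "G \<subseteq> Pow {0<..}"
    by (auto simp: G_def)
  moreover have "{0<..} \<inter> \<Inter>F \<noteq> {}" if F: "finite F" "F \<subseteq> G" for F
  proof
    assume empty: "{0<..} \<inter> \<Inter>F = {}"
    obtain f :: "nat set \<Rightarrow> nat" where f: "inj_on f F" "f ` F = {..<card F}"
      using F(1) ex_bij_betw_finite_nat[OF F(1)] by (auto simp: bij_betw_def atLeast0LessThan)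
    \<comment> \<open>\<open>g n\<close> picks a member of \<open>F\<close> that misses
      \<open>n\<close>, and \<open>f\<close> numbers the members of \<open>F\<close>, so
      \<open>f (g n)\<close> is a finite colouring.\<close>
    define g where "g n = (SOME X. X \<in> F \<and> n \<notin> X)" for n :: nat
    have g: "g n \<in> F \<and> n \<notin> g n" if "n > 0" for n
    proof -
      have "\<exists>X. X \<in> F \<and> n \<notin> X"
        using empty that by blast
      then show ?thesis
        unfolding g_def by (rule someI_ex)
    qed
    then have "f (g n) \<in> f ` F" if "n > 0" for n
      using that by blast
    then have "\<forall>n>0. f (g n) < card F"
      unfolding f(2) by simp
    then have "\<exists>x. (\<forall>j<v. 0 < x j) \<and>
        (\<exists>m. \<forall>i<u. \<exists>n>0. mat_vec D (\<lambda>j. real (x j)) i = real n \<and> f (g n) = m)"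
      by (rule image_partition_regularD[OF assms])
    then obtain x m where x: "\<forall>j<v. 0 < x j"
      "\<forall>i<u. \<exists>n>0. mat_vec D (\<lambda>j. real (x j)) i = real n \<and> f (g n) = m"
      by blast
    then obtain a where a: "\<forall>i<u. 0 < a i \<and> mat_vec D (\<lambda>j. real (x j)) i = real (a i) \<and> f (g (a i)) = m"
      by metis
    have "0 < u"
      using assms by (simp add: image_partition_regular_def)
    have ga: "g (a i) \<in> F" "a i \<notin> g (a i)" "f (g (a i)) = m" if "i < u" for i
      using a g that by simp_all
    have "g (a 0) \<in> G"
      using ga(1) \<open>0 < u\<close> F(2) by blast
    then obtain P where P: "g (a 0) = {0<..} - P" "\<not> represents_in u v D P"
      unfolding G_def by blast
    \<comment> \<open>Equal colours mean equal chosen sets, so every entry avoids the one set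
      \<open>{0<..} - P\<close> and lies in \<open>P\<close>.\<close>
    have "a i \<in> P" if "i < u" for i
    proof -
      have "g (a i) = g (a 0)"
        using ga that \<open>0 < u\<close> by (intro inj_onD[OF f(1)]) simp_all
      then show ?thesis
        using P(1) ga(2)[OF that] a that by auto
    qed
    then have "represents_in u v D P"
      unfolding represents_in_def using x(1) a by blast
    then show False
      using P(2) by simp
  qed
  ultimately obtain p where p: "p \<in> ultrafilters {0<..}" "G \<subseteq> p"
    by (rule ultrafilter_exists)
  have "represents_in u v D P" if "P \<in> p" for P
  proof (rule ccontr)
    assume "\<not> represents_in u v D P"
    then have "{0<..} - P \<in> p"
      using p(2) unfolding G_def by blast
    then show False
      using that ultrafilter_Diff_iff[OF p(1) ultrafilter_subset[OF p(1) that]] by simp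
  qed
  then show thesis
    using that p(1) by blast
qed

text \<open>
  Colour \<open>a\<close> by the colour \<open>m\<close> for which \<open>a * b\<close> has colour \<open>m\<close> for most \<open>b\<close>, with respect to an
  ultrafilter whose members contain images of \<open>E\<close>. A monochromatic image \<open>a\<close> of \<open>D\<close> for this
  colouring then has an image \<open>b\<close> of \<open>E\<close> such that all products \<open>a i * b k\<close> have the same colour.
\<close>

lemma image_partition_regular_diag_mat:
  assumes D: "image_partition_regular u v D" and E: "image_partition_regular u' v' E"
  shows "image_partition_regular (u + u') (v + v') (diag_mat u v D u' v' E)"
  unfolding image_partition_regular_def
proof (intro conjI allI impI)
  show "0 < u + u'" "0 < v + v'"
    using D by (simp_all add: image_partition_regular_def)
  show "is_dim (u + u') (v + v') (diag_mat u v D u' v' E)"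
    by (simp add: is_dim_def)
next
  fix i assume i: "i < u + u'"
  show "\<exists>j<v + v'. entry (diag_mat u v D u' v' E) i j \<noteq> 0"
  proof (cases "i < u")
    case True
    then obtain j where "j < v" "entry D i j \<noteq> 0"
      using D unfolding image_partition_regular_def by blast
    then show ?thesis
      using True by (intro exI[of _ j]) (simp add: diag_mat_def)
  next
    case False
    then have "i - u < u'"
      using i by linarith
    then obtain j where "j < v'" "entry E (i - u) j \<noteq> 0"
      using E unfolding image_partition_regular_def by blast
    then show ?thesis
      using False by (intro exI[of _ "v + j"]) (simp add: diag_mat_def)
  qed
next
  fix k :: nat and c :: "nat \<Rightarrow> nat"
  assume c: "\<forall>n>0. c n < k"
  have dims: "0 < u" "0 < u'" "col_ord D = natLeq_on v" "col_ord E = natLeq_on v'"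
    using D E by (simp_all add: image_partition_regular_def is_dim_def)
  obtain p where p: "p \<in> ultrafilters {0<..}" "\<And>P. P \<in> p \<Longrightarrow> represents_in u' v' E P"
    using image_partition_regular_ultrafilter[OF E] by blast
  have "\<exists>m<k. {b\<in>{0<..}. c (a * b) = m} \<in> p" if "a > 0" for a
  proof -
    have "{0<..} \<subseteq> (\<Union>m\<in>{..<k}. {b. c (a * b) = m})"
    proof
      fix b :: nat assume "b \<in> {0<..}"
      then have "c (a * b) < k"
        using c that by simp
      then show "b \<in> (\<Union>m\<in>{..<k}. {b. c (a * b) = m})"
        by simp
    qed
    then obtain m where "m \<in> {..<k}" "{0<..} \<inter> {b. c (a * b) = m} \<in> p"
      by (rule ultrafilter_finite_cover[OF p(1) finite_lessThan])
    then show ?thesis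
      by (auto simp: Int_def)
  qed
  then obtain d where d: "\<And>a. a > 0 \<Longrightarrow> d a < k \<and> {b\<in>{0<..}. c (a * b) = d a} \<in> p"
    by metis
  then have "\<forall>a>0. d a < k"
    by blast
  then have "\<exists>x. (\<forall>j<v. 0 < x j) \<and>
      (\<exists>m. \<forall>i<u. \<exists>n>0. mat_vec D (\<lambda>j. real (x j)) i = real n \<and> d n = m)"
    by (rule image_partition_regularD[OF D])
  then obtain x m where x: "\<forall>j<v. 0 < x j"
    "\<forall>i<u. \<exists>n>0. mat_vec D (\<lambda>j. real (x j)) i = real n \<and> d n = m"
    by blast
  then obtain a where a: "\<forall>i<u. 0 < a i \<and> mat_vec D (\<lambda>j. real (x j)) i = real (a i) \<and> d (a i) = m"
    by metis
  have "{b\<in>{0<..}. c (a i * b) = m} \<in> p" if "i \<in> {..<u}" for i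
    using a d[of "a i"] that by auto
  then have "{b\<in>{0<..}. \<forall>i\<in>{..<u}. c (a i * b) = m} \<in> p"
    by (intro ultrafilter_INT[OF p(1)]) auto
  then have "represents_in u' v' E {b\<in>{0<..}. \<forall>i\<in>{..<u}. c (a i * b) = m}"
    by (rule p(2))
  then obtain y b where y: "\<forall>j<v'. 0 < y j"
    and b: "\<forall>i<u'. 0 < b i \<and> (\<forall>l<u. c (a l * b i) = m) \<and> mat_vec E (\<lambda>j. real (y j)) i = real (b i)"
    unfolding represents_in_def mem_Collect_eq greaterThan_iff Ball_def lessThan_iff conj_assoc by blast
  \<comment> \<open>Scaling \<open>x\<close> by \<open>b 0\<close> and \<open>y\<close> by
    \<open>a 0\<close> makes the entries of the two blocks \<open>a i * b 0\<close> and
    \<open>a 0 * b l\<close>, all among the products of colour \<open>m\<close>.\<close>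
  define z where "z j = (if j < v then b 0 * x j else a 0 * y (j - v))" for j
  have "\<exists>n>0. mat_vec (diag_mat u v D u' v' E) (\<lambda>j. real (z j)) i = real n \<and> c n = m"
    if "i < u + u'" for i
  proof (cases "i < u")
    case True
    have "mat_vec D (\<lambda>j. real (z j)) i = mat_vec D (\<lambda>j. real (b 0) * real (x j)) i"
      unfolding mat_vec_def z_def
      by (intro sum.cong) (auto simp: row_support_def dims Field_natLeq_on)
    then have "mat_vec (diag_mat u v D u' v' E) (\<lambda>j. real (z j)) i = real (a i * b 0)"
      using True a by (simp add: mat_vec_diag_mat_upper dims mat_vec_scale)
    moreover have "0 < a i * b 0 \<and> c (a i * b 0) = m"
      using True a b dims(2) by simp
    ultimately show ?thesis
      by (intro exI[of _ "a i * b 0"]) simp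
  next
    case False
    define l where "l = i - u"
    have l: "i = u + l" "l < u'"
      using False \<open>i < u + u'\<close> by (simp_all add: l_def)
    have "mat_vec (diag_mat u v D u' v' E) (\<lambda>j. real (z j)) i = real (a 0 * b l)"
      using l b by (simp add: mat_vec_diag_mat_lower dims mat_vec_scale z_def)
    moreover have "0 < a 0 * b l \<and> c (a 0 * b l) = m"
      using l a b dims(1) by simp
    ultimately show ?thesis
      by (intro exI[of _ "a 0 * b l"]) simp
  qed
  moreover have "0 < z j" if "j < v + v'" for j
    using that x(1) y a b dims(1,2) by (simp add: z_def)
  ultimately show "\<exists>x. (\<forall>j<v + v'. 0 < x j) \<and> (\<exists>m. \<forall>i<u + u'. \<exists>n>0.
      mat_vec (diag_mat u v D u' v' E) (\<lambda>j. real (x j)) i = real n \<and> c n = m)"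
    by blast
qed

section \<open>The block matrix\<close>

lemma admissible_block_mat:
  assumes "countable_ordinal (col_ord A)" "admissible B" "admissible M" "row_ord A = row_ord B"
    and "\<And>i. i \<in> Field (row_ord A) \<Longrightarrow> finite (row_support A i)"
  shows "admissible (block_mat A B M)"
  using assms
  by (auto simp: admissible_def countable_ordinal_ord_sum Field_ord_sum row_support_block_mat)

text \<open>\<open>A\<close> may have infinitely many rows, but each agrees with a row of
  \<open>D\<close>. The witness lemma is therefore applied to \<open>D\<close> and \<open>B\<close>,
  and each row \<open>i\<close> of \<open>A\<close> uses the sum for its row \<open>k\<close> of
  \<open>D\<close>. The part of the vector for \<open>M\<close> is chosen separately in the same
  \<open>P\<close>.\<close>

lemma I_set_block_mat:
  assumes "real_add_semigroup S" "finite (Field (row_ord D))" "col_ord D = col_ord A"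
    and rows: "\<And>i. i \<in> Field (row_ord A) \<Longrightarrow>
      \<exists>k\<in>Field (row_ord D). \<forall>j\<in>Field (col_ord A). entry A i j = entry D k j"
    and "row_ord A = row_ord B"
    and fin: "\<And>i. i \<in> Field (row_ord A) \<Longrightarrow> finite (row_support A i) \<and> finite (row_support B i)"
    and p: "p \<in> I_set D S" and q: "q \<in> I_set B S" and pq: "uplus S p q \<in> I_set M S"
  shows "uplus S p q \<in> I_set (block_mat A B M) S"
  unfolding I_set_def
proof (intro CollectI conjI ballI)
  show "uplus S p q \<in> ultrafilters S"
    using pq by (simp add: I_set_def)
  fix P assume P: "P \<in> uplus S p q"
  obtain x y where x: "\<forall>j\<in>Field (col_ord D). x j \<in> S" and y: "\<forall>j\<in>Field (col_ord B). y j \<in> S"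
    and xy: "\<forall>k\<in>Field (row_ord D). \<forall>i\<in>Field (row_ord B). mat_vec D x k + mat_vec B y i \<in> P"
    by (rule real_add_semigroup.I_set_uplus_witness[OF assms(1,2) p q P])
  obtain z where z: "\<forall>j\<in>Field (col_ord M). z j \<in> S" "\<forall>i\<in>Field (row_ord M). mat_vec M z i \<in> P"
    using pq P unfolding I_set_def by blast
  have "mat_vec A x i + mat_vec B y i \<in> P" if i: "i \<in> Field (row_ord A)" for i
  proof -
    obtain k where k: "k \<in> Field (row_ord D)" "\<forall>j\<in>Field (col_ord A). entry A i j = entry D k j"
      using rows[OF i] by blast
    then have "row_support A i = row_support D k"
      using assms(3) by (auto simp: row_support_def)
    moreover from this have "\<forall>j\<in>row_support D k. entry A i j = entry D k j"
      using k(2) assms(3) by (auto simp: row_support_def)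
    ultimately have "mat_vec A x i = mat_vec D x k"
      by (simp add: mat_vec_def)
    then show ?thesis
      using xy k(1) i assms(5) by simp
  qed
  then show "\<exists>x. (\<forall>j\<in>Field (col_ord (block_mat A B M)). x j \<in> S) \<and>
      (\<forall>i\<in>Field (row_ord (block_mat A B M)). mat_vec (block_mat A B M) x i \<in> P)"
    using x y z assms(3) fin
    by (intro exI[of _ "case_sum x (case_sum y z)"])
      (auto simp: Field_ord_sum mat_vec_block_mat mat_vec_block_mat_Inr)
qed

theorem theorem3p27:
  fixes S :: "real set"
    and u v :: nat
    and D :: "(nat, nat) omat"
    and \<alpha> :: "'a rel" and \<delta> :: "'d rel"
    and A :: "('a, nat) omat"
    and B :: "('a, 'd) omat"
    and M :: "('b, 'e) omat"
  assumes "dense_subsemigroup S"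
    and "0 < u" and "0 < v"
    and "image_partition_regular u v D"
    and "countable_ordinal \<alpha>" and "Field \<alpha> \<noteq> {}"
    and "countable_ordinal \<delta>" and "Field \<delta> \<noteq> {}"
    and "row_ord A = \<alpha>" and "col_ord A = natLeq_on v"
    and "\<forall>i\<in>Field \<alpha>. \<exists>k<u. \<forall>j<v. entry A i j = entry D k j"
    and "row_ord B = \<alpha>" and "col_ord B = \<delta>"
    and "B \<in> R0 S"
    and "M \<in> N0 S"
  shows "block_mat A B M \<in> N0 S"
proof -
  have B: "admissible B" and M: "admissible M"
    using assms(14,15) by (simp_all add: R0_def N0_def)
  have sg: "real_add_semigroup S"
    using assms(1) by unfold_locales (simp add: dense_subsemigroup_def)
  interpret real_add_semigroup S
    by (fact sg)
  have dimD: "is_dim u v D" "finite (Field (row_ord D))" "Field (row_ord D) \<noteq> {}"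
    using assms(2,4) by (auto simp: image_partition_regular_def is_dim_def Field_natLeq_on)
  have finA: "finite (row_support A i)" for i
    by (simp add: row_support_def assms(10) Field_natLeq_on)
  have "admissible (block_mat A B M)"
    using B M finA assms(9,12)
    by (intro admissible_block_mat)
      (simp_all add: assms(10) countable_ordinal_def natLeq_on_Well_order)
  moreover have "I_set E S \<inter> I_set (block_mat A B M) S \<inter> smallest_ideal (uplus S) (O_plus S) \<noteq> {}"
    if ipr: "finite_ipr E" for E
  proof -
    obtain u' v' where E: "image_partition_regular u' v' E"
      using ipr unfolding finite_ipr_def by blast
    then have "is_dim u' v' E"
      by (simp add: image_partition_regular_def)
    note diag = I_set_diag_mat[OF dimD(1) this, of S]
    have "finite_ipr (diag_mat u v D u' v' E)"
      using image_partition_regular_diag_mat[OF assms(4) E] by (auto simp: finite_ipr_def)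
    then obtain q where q: "q \<in> I_set D S" "q \<in> I_set E S" "q \<in> I_set M S"
      "q \<in> smallest_ideal (uplus S) (O_plus S)"
      using assms(15) diag unfolding N0_def by blast
    define T where "T = I0_set D S"
    have T_eq: "T = I_set D S \<inter> O_plus S"
      unfolding T_def by (rule I0_set_eq[OF dimD(3)])
    have T_closed: "uf_closed S T"
      using uf_closed_Inter[of "{I_set D S, O_plus S}" S] uf_closed_I_set uf_closed_O_plus
      by (auto simp: T_eq)
    have T_add: "s \<oplus> t \<in> T" if "s \<in> T" "t \<in> T" for s t
      using I0_set_uplus[OF assms(1) dimD(2,3)] that by (simp add: T_def)
    have "q \<in> T"
      using q(1,4) smallest_ideal_O_plus_subset[OF O_plus_nonempty[OF assms(1)]]
      by (auto simp: T_eq)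
    then have "left_ideal (uplus S) T ((\<lambda>t. t \<oplus> q) ` T)"
      using T_add by (auto simp: left_ideal_def simp flip: uplus_assoc)
    \<comment> \<open>Membership of \<open>B\<close> in \<open>R0\<close> is used with
      \<open>D\<close>, not \<open>E\<close>, as the finite matrix, because the left ideal is one of
      \<open>T\<close>.\<close>
    then obtain r where r: "r \<in> (\<lambda>t. t \<oplus> q) ` T" "r \<in> I0_set B S"
      using assms(4,14) unfolding R0_def T_def finite_ipr_def by blast
    obtain s where s: "s \<in> T" "q = s \<oplus> r"
      using smallest_ideal_left_ideal_subsemigroup[OF uf_closed_O_plus O_plus_uplus T_closed T_add
          _ \<open>q \<in> T\<close> q(4) r(1)] T_eq by blast
    have "Field (row_ord B) \<noteq> {}"
      using assms(6,12) by simp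
    then have "r \<in> I_set B S"
      using r(2) I0_set_eq[of B S] by simp
    moreover have "\<exists>k\<in>Field (row_ord D). \<forall>j\<in>Field (col_ord A). entry A i j = entry D k j"
      if "i \<in> Field (row_ord A)" for i
      using assms(9-11) dimD(1) that by (auto simp: is_dim_def Field_natLeq_on)
    moreover have "finite (row_support A i) \<and> finite (row_support B i)"
      if "i \<in> Field (row_ord A)" for i
      using finA B that assms(9,12) by (simp add: admissible_def)
    ultimately have "q \<in> I_set (block_mat A B M) S"
      using I_set_block_mat[OF sg dimD(2), of A B s r M] s q(3) T_eq dimD(1) assms(9,10,12)
      by (auto simp: is_dim_def)
    then show ?thesis
      using q(2,4) by blast
  qed
  ultimately show ?thesis
    by (simp add: N0_def)
qed

end
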